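(* The dynamical system $\langle\mathcal P(\omega)/\mathrm{Fin},\sigma\rangle$ is polarized.
   Context: $\mathcal P(\omega)/\mathrm{Fin}$ is $\mathcal P(\omega)$ modulo finite sets, $\sigma([A])=[A+1]$. For a Boolean algebra $\mathbb A$ with automorphism $\alpha$: a partition of $\mathbb A$ is a finite set of nonzero pairwise disjoint elements with join $\mathbf 1$; $\mathcal A'$ refines $\mathcal A$ if each member of $\mathcal A'$ is below a member of $\mathcal A$, with natural map $\pi:\mathcal A'\to\mathcal A$; the digraph $\langle\mathcal A,\to_\alpha\rangle$ has $x\to_\alpha y$ iff $\alpha(x)\wedge y\ne\mathbf 0$. Digraphs are finite; strongly connected means every vertex reaches every vertex by a walk. An epimorphism $\phi:\langle\mathcal V,\to_{\mathcal V}\rangle\to\langle\mathcal U,\to_{\mathcal U}\rangle$ is a surjection with $u\to_{\mathcal U}u'$ iff some $v\in\phi^{-1}(u),v'\in\phi^{-1}(u')$ have $v\to_{\mathcal V}v'$. A virtual refinement of $\langle\mathcal A,\to_\alpha\rangle$ is $(\phi,\langle\mathcal V,\to\rangle)$ with $\langle\mathcal V,\to\rangle$ strongly connected and $\phi$ an epimorphism onto $\langle\mathcal A,\to_\alpha\rangle$; a partition $\mathcal A'$ realizes it if $\mathcal A'$ refines $\mathcal A$ and some digraph isomorphism $\psi:\langle\mathcal V,\to\rangle\to\langle\mathcal A',\to_\alpha\rangle$ satisfies $\pi\circ\psi=\phi$. Epimorphisms $\phi,\psi$ from strongly connected digraphs onto the same digraph are compatible if there are a strongly connected digraph $\mathcal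 W$ and epimorphisms $\bar\phi,\bar\psi$ from $\mathcal W$ onto their domains with $\phi\circ\bar\phi=\psi\circ\bar\psi$; otherwise incompatible. A virtual refinement $(\phi,\langle\mathcal V,\to\rangle)$ of $\langle\mathcal A,\to_\alpha\rangle$ is polarized if either some partition realizes it or some partition $\mathcal A'$ refining $\mathcal A$ has natural map $\pi:\langle\mathcal A',\to_\alpha\rangle\to\langle\mathcal A,\to_\alpha\rangle$ incompatible with $\phi$. The system is polarized if every virtual refinement of every $\langle\mathcal A,\to_\alpha\rangle$ is polarized. *)

theory Defs
  imports "Graph_Theory.Digraph_Component"
begin

section \<open>Boolean algebras with an automorphism\<close>

definition boolean_automorphism :: "('a::boolean_algebra \<Rightarrow> 'a) \<Rightarrow> bool" where
  "boolean_automorphism \<alpha> \<longleftrightarrow> bij \<alpha> \<and>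
     (\<forall>x y. \<alpha> (inf x y) = inf (\<alpha> x) (\<alpha> y)) \<and>
     (\<forall>x y. \<alpha> (sup x y) = sup (\<alpha> x) (\<alpha> y)) \<and>
     (\<forall>x. \<alpha> (- x) = - \<alpha> x)"

text \<open>Inserting \<open>bot\<close> does not change the join; it makes \<open>Sup_fin\<close>, which is only specified
  on nonempty sets, applicable to the empty set as well.\<close>

definition is_partition :: "'a::boolean_algebra set \<Rightarrow> bool" where
  "is_partition P \<longleftrightarrow> finite P \<and> bot \<notin> P \<and>
     pairwise (\<lambda>x y. inf x y = bot) P \<and> Sup_fin (insert bot P) = top"

definition refines :: "'a::boolean_algebra set \<Rightarrow> 'a set \<Rightarrow> bool" where
  "refines P' P \<longleftrightarrow> (\<forall>x\<in>P'. \<exists>y\<in>P. x \<le> y)"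

definition natural_map :: "'a::boolean_algebra set \<Rightarrow> 'a \<Rightarrow> 'a" where
  "natural_map P x = (THE y. y \<in> P \<and> x \<le> y)"

lemma natural_map_unique:
  assumes "is_partition P'" "is_partition P" "refines P' P" "x \<in> P'"
  shows "\<exists>!y. y \<in> P \<and> x \<le> y"
proof -
  obtain y where y: "y \<in> P" "x \<le> y"
    using assms(3,4) by (auto simp: refines_def)
  have "z = y" if z: "z \<in> P" "x \<le> z" for z
  proof (rule ccontr)
    assume "z \<noteq> y"
    then have "inf z y = bot"
      using assms(2) y z by (auto simp: is_partition_def pairwise_def)
    moreover have "x \<le> inf z y"
      using y z by simp
    ultimately show False
      using assms(1,4) by (auto simp: is_partition_def dest: bot.extremum_uniqueI)
  qed
  with y show ?thesis by blast
qed

lemma natural_map_props: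
  assumes "is_partition P'" "is_partition P" "refines P' P" "x \<in> P'"
  shows "natural_map P x \<in> P" "x \<le> natural_map P x"
  using theI'[OF natural_map_unique[OF assms]] by (simp_all add: natural_map_def)


section \<open>Finite digraphs, epimorphisms, and virtual refinements\<close>

text \<open>Digraphs have at most one arc for each ordered pair of vertices, and may have loops.\<close>

definition partition_digraph ::
    "('a::boolean_algebra \<Rightarrow> 'a) \<Rightarrow> 'a set \<Rightarrow> 'a pair_pre_digraph" where
  "partition_digraph \<alpha> P =
     \<lparr> pverts = P, parcs = {(x, y). x \<in> P \<and> y \<in> P \<and> inf (\<alpha> x) y \<noteq> bot} \<rparr>"

definition sc_digraph :: "'v pair_pre_digraph \<Rightarrow> bool" where
  "sc_digraph V \<longleftrightarrow> pair_fin_digraph V \<and> strongly_connected (with_proj V)"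

text \<open>Only the values of a map on the vertex set of its domain matter.\<close>

definition epimorphism ::
    "('v \<Rightarrow> 'u) \<Rightarrow> 'v pair_pre_digraph \<Rightarrow> 'u pair_pre_digraph \<Rightarrow> bool" where
  "epimorphism \<phi> V U \<longleftrightarrow> \<phi> ` pverts V = pverts U \<and>
     (\<forall>u\<in>pverts U. \<forall>u'\<in>pverts U. (u, u') \<in> parcs U \<longleftrightarrow>
        (\<exists>v\<in>pverts V. \<exists>v'\<in>pverts V. \<phi> v = u \<and> \<phi> v' = u' \<and> (v, v') \<in> parcs V))"

definition digraph_isomorphism_map ::
    "('v \<Rightarrow> 'u) \<Rightarrow> 'v pair_pre_digraph \<Rightarrow> 'u pair_pre_digraph \<Rightarrow> bool" where
  "digraph_isomorphism_map \<psi> V U \<longleftrightarrow> bij_betw \<psi> (pverts V) (pverts U) \<and>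
     (\<forall>v\<in>pverts V. \<forall>v'\<in>pverts V. (v, v') \<in> parcs V \<longleftrightarrow> (\<psi> v, \<psi> v') \<in> parcs U)"

text \<open>Every finite digraph is isomorphic to one whose vertices are natural numbers, so taking the
  witness \<open>W\<close> on this type is no restriction.\<close>

definition compatible_epis ::
    "('v \<Rightarrow> 'u) \<Rightarrow> 'v pair_pre_digraph \<Rightarrow> ('w \<Rightarrow> 'u) \<Rightarrow> 'w pair_pre_digraph \<Rightarrow> bool" where
  "compatible_epis \<phi> V \<psi> V' \<longleftrightarrow>
     (\<exists>(W :: nat pair_pre_digraph) \<phi>' \<psi>'. sc_digraph W \<and>
        epimorphism \<phi>' W V \<and> epimorphism \<psi>' W V' \<and>
        (\<forall>w\<in>pverts W. \<phi> (\<phi>' w) = \<psi> (\<psi>' w)))"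

text \<open>Incompatibility is only meaningful for epimorphisms from strongly connected digraphs onto a
  common digraph \<open>U\<close>, so this is part of the definition.\<close>

definition incompatible_epis ::
    "'u pair_pre_digraph \<Rightarrow> ('v \<Rightarrow> 'u) \<Rightarrow> 'v pair_pre_digraph \<Rightarrow>
       ('w \<Rightarrow> 'u) \<Rightarrow> 'w pair_pre_digraph \<Rightarrow> bool" where
  "incompatible_epis U \<phi> V \<psi> V' \<longleftrightarrow>
     sc_digraph V \<and> epimorphism \<phi> V U \<and> sc_digraph V' \<and> epimorphism \<psi> V' U \<and>
     \<not> compatible_epis \<phi> V \<psi> V'"

definition virtual_refinement ::
    "('a::boolean_algebra \<Rightarrow> 'a) \<Rightarrow> 'a set \<Rightarrow> ('v \<Rightarrow> 'a) \<Rightarrow> 'v pair_pre_digraph \<Rightarrow> bool" where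
  "virtual_refinement \<alpha> P \<phi> V \<longleftrightarrow>
     sc_digraph V \<and> epimorphism \<phi> V (partition_digraph \<alpha> P)"

definition realizes ::
    "('a::boolean_algebra \<Rightarrow> 'a) \<Rightarrow> 'a set \<Rightarrow> 'a set \<Rightarrow>
       ('v \<Rightarrow> 'a) \<Rightarrow> 'v pair_pre_digraph \<Rightarrow> bool" where
  "realizes \<alpha> P' P \<phi> V \<longleftrightarrow> is_partition P' \<and> refines P' P \<and>
     (\<exists>\<psi>. digraph_isomorphism_map \<psi> V (partition_digraph \<alpha> P') \<and>
          (\<forall>v\<in>pverts V. natural_map P (\<psi> v) = \<phi> v))"

definition polarized_refinement ::
    "('a::boolean_algebra \<Rightarrow> 'a) \<Rightarrow> 'a set \<Rightarrow> ('v \<Rightarrow> 'a) \<Rightarrow> 'v pair_pre_digraph \<Rightarrow> bool" where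
  "polarized_refinement \<alpha> P \<phi> V \<longleftrightarrow>
     (\<exists>P'. realizes \<alpha> P' P \<phi> V) \<or>
     (\<exists>P'. is_partition P' \<and> refines P' P \<and>
        incompatible_epis (partition_digraph \<alpha> P)
          (natural_map P) (partition_digraph \<alpha> P') \<phi> V)"

text \<open>The type argument is the type of the vertices of the virtual refinements. To quantify over
  all finite digraphs, it is to be kept as a type variable (or instantiated with an infinite
  type).\<close>

definition polarized_system ::
    "'v itself \<Rightarrow> ('a::boolean_algebra \<Rightarrow> 'a) \<Rightarrow> bool" where
  "polarized_system _ \<alpha> \<longleftrightarrow> boolean_automorphism \<alpha> \<and>
     (\<forall>P (\<phi> :: 'v \<Rightarrow> 'a) V. is_partition P \<longrightarrow> virtual_refinement \<alpha> P \<phi> V \<longrightarrow>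
        polarized_refinement \<alpha> P \<phi> V)"


section \<open>The algebra of sets of natural numbers modulo finite sets, and the shift\<close>

definition eq_mod_fin :: "nat set \<Rightarrow> nat set \<Rightarrow> bool" where
  "eq_mod_fin A B \<longleftrightarrow> finite ((A - B) \<union> (B - A))"

lemma eq_mod_fin_binary:
  assumes "eq_mod_fin A A'" "eq_mod_fin B B'"
    and "(C - C') \<union> (C' - C) \<subseteq> ((A - A') \<union> (A' - A)) \<union> ((B - B') \<union> (B' - B))"
  shows "eq_mod_fin C C'"
  using assms unfolding eq_mod_fin_def by (meson finite_UnI finite_subset)

lemma equivp_eq_mod_fin: "equivp eq_mod_fin"
proof (rule equivpI)
  show "reflp eq_mod_fin" by (auto simp: reflp_def eq_mod_fin_def)
  show "symp eq_mod_fin" by (auto simp: symp_def eq_mod_fin_def)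
  show "transp eq_mod_fin"
  proof (rule transpI)
    fix A B C assume *: "eq_mod_fin A B" "eq_mod_fin B C"
    have "(A - C) \<union> (C - A) \<subseteq> ((A - B) \<union> (B - A)) \<union> ((B - C) \<union> (C - B))" by blast
    with * show "eq_mod_fin A C"
      unfolding eq_mod_fin_def by (meson finite_UnI finite_subset)
  qed
qed

quotient_type pow_mod_fin = "nat set" / eq_mod_fin
  by (rule equivp_eq_mod_fin)

instantiation pow_mod_fin :: boolean_algebra
begin

lift_definition bot_pow_mod_fin :: pow_mod_fin is "{}" .

lift_definition top_pow_mod_fin :: pow_mod_fin is UNIV .

lift_definition inf_pow_mod_fin :: "pow_mod_fin \<Rightarrow> pow_mod_fin \<Rightarrow> pow_mod_fin" is "(\<inter>)"
  by (erule (1) eq_mod_fin_binary) blast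

lift_definition sup_pow_mod_fin :: "pow_mod_fin \<Rightarrow> pow_mod_fin \<Rightarrow> pow_mod_fin" is "(\<union>)"
  by (erule (1) eq_mod_fin_binary) blast

lift_definition uminus_pow_mod_fin :: "pow_mod_fin \<Rightarrow> pow_mod_fin" is "uminus"
  unfolding eq_mod_fin_def by (erule rev_finite_subset) auto

lift_definition minus_pow_mod_fin :: "pow_mod_fin \<Rightarrow> pow_mod_fin \<Rightarrow> pow_mod_fin" is "(-)"
  by (erule (1) eq_mod_fin_binary) blast

lift_definition less_eq_pow_mod_fin :: "pow_mod_fin \<Rightarrow> pow_mod_fin \<Rightarrow> bool"
  is "\<lambda>A B. finite (A - B)"
proof -
  fix A A' B B' assume *: "eq_mod_fin A A'" "eq_mod_fin B B'"
  have "A - B \<subseteq> (A' - B') \<union> ((A - A') \<union> (A' - A)) \<union> ((B - B') \<union> (B' - B))"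
    "A' - B' \<subseteq> (A - B) \<union> ((A - A') \<union> (A' - A)) \<union> ((B - B') \<union> (B' - B))" by blast+
  with * show "finite (A - B) = finite (A' - B')"
    unfolding eq_mod_fin_def by (meson finite_UnI finite_subset)
qed

definition less_pow_mod_fin :: "pow_mod_fin \<Rightarrow> pow_mod_fin \<Rightarrow> bool" where
  "less_pow_mod_fin x y \<longleftrightarrow> x \<le> y \<and> \<not> y \<le> x"

instance
proof
  fix x y z :: pow_mod_fin
  show "x < y \<longleftrightarrow> x \<le> y \<and> \<not> y \<le> x" by (rule less_pow_mod_fin_def)
  show "x \<le> x" by transfer simp
  show "x \<le> z" if "x \<le> y" "y \<le> z"
    using that
  proof transfer
    fix A B C :: "nat set" assume *: "finite (A - B)" "finite (B - C)"
    have "A - C \<subseteq> (A - B) \<union> (B - C)" by blast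
    with * show "finite (A - C)" by (meson finite_UnI finite_subset)
  qed
  show "x = y" if "x \<le> y" "y \<le> x"
    using that by transfer (simp add: eq_mod_fin_def)
  show "inf x y \<le> x" by transfer (simp add: Diff_Int_distrib2 Int_Diff)
  show "inf x y \<le> y" by transfer (simp add: Int_Diff)
  show "x \<le> inf y z" if "x \<le> y" "x \<le> z"
    using that by transfer (simp add: Diff_Int)
  show "x \<le> sup x y" by transfer (simp add: Diff_eq_empty_iff[THEN iffD2])
  show "y \<le> sup x y" by transfer (simp add: Diff_eq_empty_iff[THEN iffD2])
  show "sup y z \<le> x" if "y \<le> x" "z \<le> x"
    using that by transfer (simp add: Un_Diff)
  show "bot \<le> x" by transfer simp
  show "x \<le> top" by transfer simp
  show "sup x (inf y z) = inf (sup x y) (sup x z)"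
    by transfer (simp add: Un_Int_distrib eq_mod_fin_def)
  show "inf x (- x) = bot" by transfer (simp add: eq_mod_fin_def)
  show "sup x (- x) = top" by transfer (simp add: eq_mod_fin_def)
  show "x - y = inf x (- y)" by transfer (simp add: eq_mod_fin_def Diff_eq)
qed

end

lift_definition shift :: "pow_mod_fin \<Rightarrow> pow_mod_fin" is "\<lambda>A. Suc ` A"
proof -
  fix A B assume "eq_mod_fin A B"
  then have "finite (Suc ` ((A - B) \<union> (B - A)))" by (simp add: eq_mod_fin_def)
  then show "eq_mod_fin (Suc ` A) (Suc ` B)"
    unfolding eq_mod_fin_def by (rule rev_finite_subset) auto
qed

lemma boolean_automorphism_shift: "boolean_automorphism shift"
proof -
  have "inj shift"
  proof (rule injI, transfer)
    fix A B assume "eq_mod_fin (Suc ` A) (Suc ` B)"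
    then have "finite (Suc ` ((A - B) \<union> (B - A)))"
      unfolding eq_mod_fin_def by (rule rev_finite_subset) auto
    then show "eq_mod_fin A B" by (simp add: eq_mod_fin_def finite_image_iff)
  qed
  moreover have "surj shift"
  proof (rule surjI[where f = "map_fun rep_pow_mod_fin abs_pow_mod_fin (\<lambda>A. {n. Suc n \<in> A})"])
    fix x
    let ?A = "rep_pow_mod_fin x"
    have "eq_mod_fin (Suc ` {n. Suc n \<in> ?A}) ?A"
      unfolding eq_mod_fin_def
      by (rule finite_subset[of _ "{0}"]) (auto simp: image_iff dest: not0_implies_Suc)
    then have "abs_pow_mod_fin (Suc ` {n. Suc n \<in> ?A}) = x"
      by (metis Quotient_abs_rep Quotient_pow_mod_fin pow_mod_fin.abs_eq_iff)
    then show "shift (map_fun rep_pow_mod_fin abs_pow_mod_fin (\<lambda>A. {n. Suc n \<in> A}) x) = x"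
      by (simp add: shift.abs_eq)
  qed
  moreover have "shift (inf x y) = inf (shift x) (shift y)" for x y
    by transfer (simp add: eq_mod_fin_def image_Int)
  moreover have "shift (sup x y) = sup (shift x) (shift y)" for x y
    by transfer (simp add: eq_mod_fin_def image_Un)
  moreover have "shift (- x) = - shift x" for x
  proof transfer
    fix A show "eq_mod_fin (Suc ` (- A)) (- Suc ` A)"
      unfolding eq_mod_fin_def
      by (rule finite_subset[of _ "{0}"]) (auto simp: image_iff dest: not0_implies_Suc)
  qed
  ultimately show ?thesis by (simp add: boolean_automorphism_def bij_def)
qed

end

(* A partition of P(omega)/Fin is a colouring c of the naturals, and its digraph records the
   colour changes seen infinitely often; realizing a virtual refinement V means lifting c to a walk
   in V that uses every arc infinitely often. The set of (start, traversed arcs, end) of all lifts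
   of c to V over an interval is multiplicative under concatenation of intervals, so by Ramsey's
   theorem there is an infinite set H of marks between any two of which it is a constant
   idempotent e. If e contains a closed walk traversing all arcs of V, concatenating its copies
   between consecutive marks realizes V. Otherwise refine c by recording the marks and the lifts
   since the previous mark: a common strongly connected cover W would have a closed covering walk
   starting at a mark, and following it puts such a closed walk of V into e. *)

theory Submission
  imports Defs "HOL-Library.Ramsey"
begin

section \<open>Partitions and their digraphs coded by colourings of the naturals\<close>

definition cell :: "(nat \<Rightarrow> 'x) \<Rightarrow> 'x \<Rightarrow> pow_mod_fin" where
  "cell c x = abs_pow_mod_fin (c -` {x})"

text \<open>A colour used only finitely often has cell \<open>bot\<close>, which no partition may
  contain. The colour partition therefore ranges over the recurrent colours.\<close>

definition recurrent :: "(nat \<Rightarrow> 'x) \<Rightarrow> 'x set" where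
  "recurrent c = {x. infinite (c -` {x})}"

text \<open>This is the arc relation in terms of colours: \<open>shift\<close> moves position n to n
  + 1, so the shifted cell of x meets the cell of y exactly at the successors of the positions
  counted here.\<close>

definition recurrent_step :: "(nat \<Rightarrow> 'x) \<Rightarrow> 'x \<Rightarrow> 'x \<Rightarrow> bool" where
  "recurrent_step c x y \<longleftrightarrow> infinite {n. c n = x \<and> c (Suc n) = y}"

abbreviation colour_partition :: "(nat \<Rightarrow> 'x) \<Rightarrow> pow_mod_fin set" where
  "colour_partition c \<equiv> cell c ` recurrent c"

lemma abs_eq_bot_iff: "abs_pow_mod_fin A = bot \<longleftrightarrow> finite A"
  unfolding bot_pow_mod_fin_def by (simp add: pow_mod_fin.abs_eq_iff eq_mod_fin_def)

lemma cell_le_iff: "cell c x \<le> cell d y \<longleftrightarrow> finite {n. c n = x \<and> d n \<noteq> y}"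
proof -
  have "c -` {x} - d -` {y} = {n. c n = x \<and> d n \<noteq> y}" by auto
  then show ?thesis by (simp add: cell_def less_eq_pow_mod_fin.abs_eq)
qed

lemma inf_cell_eq_bot: "x \<noteq> y \<Longrightarrow> inf (cell c x) (cell c y) = bot"
proof -
  assume "x \<noteq> y"
  then have "c -` {x} \<inter> c -` {y} = {}" by auto
  then show ?thesis by (simp add: cell_def inf_pow_mod_fin.abs_eq abs_eq_bot_iff)
qed

lemma cell_neq_bot: "x \<in> recurrent c \<Longrightarrow> cell c x \<noteq> bot"
  by (simp add: recurrent_def cell_def abs_eq_bot_iff)

lemma inj_on_cell: "inj_on (cell c) (recurrent c)"
  by (rule inj_onI) (metis cell_neq_bot inf.idem inf_cell_eq_bot)

lemma arc_iff_recurrent_step: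
  "inf (shift (cell c x)) (cell c y) = bot \<longleftrightarrow> \<not> recurrent_step c x y"
proof -
  have "Suc ` (c -` {x}) \<inter> c -` {y} = Suc ` {n. c n = x \<and> c (Suc n) = y}" by auto
  then show ?thesis
    by (simp add: cell_def shift.abs_eq inf_pow_mod_fin.abs_eq abs_eq_bot_iff
        recurrent_step_def finite_image_iff)
qed

lemma recurrent_step_in_recurrent:
  assumes "recurrent_step c x y"
  shows "x \<in> recurrent c" "y \<in> recurrent c"
proof -
  have inf: "infinite {n. c n = x \<and> c (Suc n) = y}"
    using assms by (simp add: recurrent_step_def)
  show "x \<in> recurrent c"
    unfolding recurrent_def using infinite_super[OF _ inf, of "c -` {x}"] by auto
  have "infinite (Suc ` {n. c n = x \<and> c (Suc n) = y})"
    using inf by (simp add: finite_image_iff)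
  then show "y \<in> recurrent c"
    unfolding recurrent_def
    using infinite_super[of "Suc ` {n. c n = x \<and> c (Suc n) = y}" "c -` {y}"] by auto
qed

lemma partition_digraph_colour:
  "pverts (partition_digraph shift (colour_partition c)) = colour_partition c"
  "parcs (partition_digraph shift (colour_partition c)) =
     {(cell c x, cell c y) | x y. recurrent_step c x y}"
  unfolding partition_digraph_def
  using recurrent_step_in_recurrent[of c] by (auto simp: arc_iff_recurrent_step) blast

lemma cell_arc_iff:
  assumes "x \<in> recurrent c" "y \<in> recurrent c"
  shows "(cell c x, cell c y) \<in> parcs (partition_digraph shift (colour_partition c))
    \<longleftrightarrow> recurrent_step c x y"
  using assms by (simp add: partition_digraph_def arc_iff_recurrent_step)

lemma finite_recurrent:
  assumes "finite (range c)"
  shows "finite (recurrent c)"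
proof (rule finite_subset[OF _ assms])
  show "recurrent c \<subseteq> range c"
    by (auto simp: recurrent_def image_iff dest!: infinite_imp_nonempty)
qed

text \<open>Finitely many values have finite fibres in total a finite set of positions; N is chosen
  beyond all of them.\<close>

lemma pigeonhole_eventually:
  fixes g :: "nat \<Rightarrow> 'x"
  assumes "finite (range g)"
  obtains N where "\<And>n. n \<ge> N \<Longrightarrow> infinite (g -` {g n})"
proof -
  have "finite (\<Union>x \<in> {x \<in> range g. finite (g -` {x})}. g -` {x})"
    using assms by (intro finite_UN_I) auto
  then obtain N where N: "\<forall>n \<in> (\<Union>x \<in> {x \<in> range g. finite (g -` {x})}. g -` {x}). n < N"
    using finite_nat_set_iff_bounded by blast
  have "infinite (g -` {g n})" if "n \<ge> N" for n
  proof
    assume "finite (g -` {g n})"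
    then have "n < N" using N by blast
    with \<open>n \<ge> N\<close> show False by simp
  qed
  then show ?thesis by (rule that)
qed

text \<open>The pigeonhole principle is applied to the colouring of n by the pair of colours at n
  and n + 1. From some N on, the colouring itself is thus a walk in its digraph.\<close>

lemma eventually_recurrent_step:
  assumes "finite (range c)"
  obtains N where "\<And>n. n \<ge> N \<Longrightarrow> recurrent_step c (c n) (c (Suc n))"
proof -
  have "range (\<lambda>n. (c n, c (Suc n))) \<subseteq> range c \<times> range c" by auto
  then have "finite (range (\<lambda>n. (c n, c (Suc n))))"
    using assms by (meson finite_SigmaI finite_subset)
  then obtain N where
    "\<And>n. n \<ge> N \<Longrightarrow> infinite ((\<lambda>n. (c n, c (Suc n))) -` {(c n, c (Suc n))})"
    using pigeonhole_eventually by blast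
  moreover have "(\<lambda>n. (c n, c (Suc n))) -` {(x, y)} = {n. c n = x \<and> c (Suc n) = y}" for x y
    by auto
  ultimately show ?thesis by (intro that[of N]) (simp add: recurrent_step_def)
qed

lemma Sup_fin_cells:
  assumes "finite X"
  shows "Sup_fin (insert bot (cell c ` X)) = abs_pow_mod_fin (c -` X)"
  using assms
proof (induction X rule: finite_induct)
  case empty
  show ?case by (simp add: bot_pow_mod_fin_def)
next
  case (insert x X)
  have "Sup_fin (insert (cell c x) (insert bot (cell c ` X)))
      = sup (cell c x) (abs_pow_mod_fin (c -` X))"
    using insert by (subst Sup_fin.insert) auto
  also have "\<dots> = abs_pow_mod_fin (c -` insert x X)"
    by (simp add: cell_def sup_pow_mod_fin.abs_eq flip: vimage_Un)
  finally show ?case by (simp add: insert_commute)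
qed

text \<open>Past some position every colour is recurrent, so the recurrent cells cover a cofinite
  set and their join is \<open>top\<close>.\<close>

lemma is_partition_colour:
  assumes "finite (range c)"
  shows "is_partition (colour_partition c)"
proof -
  obtain N where N: "\<And>n. n \<ge> N \<Longrightarrow> infinite (c -` {c n})"
    using pigeonhole_eventually[OF assms] by blast
  have "- (c -` recurrent c) \<subseteq> {..<N}"
    using N by (auto simp: recurrent_def not_less[symmetric])
  then have "finite (- (c -` recurrent c))" by (rule finite_subset) simp
  then have "abs_pow_mod_fin (c -` recurrent c) = top"
    by (simp add: top_pow_mod_fin_def pow_mod_fin.abs_eq_iff eq_mod_fin_def Compl_eq_Diff_UNIV)
  then show ?thesis
    using finite_recurrent[OF assms] inf_cell_eq_bot[of _ _ c]
    by (auto simp: is_partition_def Sup_fin_cells pairwise_def dest: cell_neq_bot)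
      (metis cell_neq_bot)
qed

text \<open>Representatives of the members of P miss only finitely many points and overlap pairwise
  in finite sets. Assigning each point to one member whose representative contains it alters each
  class only finitely. The colours are the members of P themselves, so a colour equals its
  cell.\<close>

lemma partition_colouring:
  assumes "is_partition P"
  obtains c where "range c \<subseteq> P" "recurrent c = P" "\<And>a. a \<in> P \<Longrightarrow> cell c a = a"
proof -
  let ?R = rep_pow_mod_fin
  have abs_rep: "abs_pow_mod_fin (?R a) = a" for a
    by (metis Quotient_abs_rep Quotient_pow_mod_fin)
  have fin: "finite P" and nb: "bot \<notin> P" and top: "Sup_fin (insert bot P) = top"
    and disj: "\<And>a b. a \<in> P \<Longrightarrow> b \<in> P \<Longrightarrow> a \<noteq> b \<Longrightarrow> inf a b = bot"
    using assms by (auto simp: is_partition_def pairwise_def)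
  have "Sup_fin (insert bot Q) = abs_pow_mod_fin (\<Union>a\<in>Q. ?R a)" if "finite Q" for Q
    using that
  proof (induction Q rule: finite_induct)
    case empty
    show ?case by (simp add: bot_pow_mod_fin_def)
  next
    case (insert x Q)
    have "Sup_fin (insert x (insert bot Q)) = sup x (abs_pow_mod_fin (\<Union>a\<in>Q. ?R a))"
      using insert by (subst Sup_fin.insert) auto
    also have "\<dots> = sup (abs_pow_mod_fin (?R x)) (abs_pow_mod_fin (\<Union>a\<in>Q. ?R a))"
      by (simp add: abs_rep)
    finally show ?case by (simp add: insert_commute sup_pow_mod_fin.abs_eq)
  qed
  with fin top have "abs_pow_mod_fin (\<Union>a\<in>P. ?R a) = top" by simp
  then have cof: "finite (- (\<Union>a\<in>P. ?R a))"
    by (simp add: top_pow_mod_fin_def pow_mod_fin.abs_eq_iff eq_mod_fin_def Compl_eq_Diff_UNIV)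
  have "finite (?R a \<inter> ?R b)" if "a \<in> P" "b \<in> P" "a \<noteq> b" for a b
    using disj[OF that] abs_rep by (metis abs_eq_bot_iff inf_pow_mod_fin.abs_eq)
  then have overlap: "finite (\<Union>a\<in>P. \<Union>b\<in>P - {a}. ?R a \<inter> ?R b)"
    using fin by blast
  have "P \<noteq> {}"
    using cof by auto
  then obtain a0 where a0: "a0 \<in> P" by blast
  \<comment> \<open>The default \<open>a0\<close> is given to the finitely many points that lie in
    no representative.\<close>
  define c where "c n = (if \<exists>a\<in>P. n \<in> ?R a then SOME a. a \<in> P \<and> n \<in> ?R a else a0)" for n
  have c: "c n \<in> P \<and> n \<in> ?R (c n)" if "\<exists>a\<in>P. n \<in> ?R a" for n
  proof -
    have "\<exists>a. a \<in> P \<and> n \<in> ?R a" using that by blast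
    from someI_ex[OF this] show ?thesis unfolding c_def using that by simp
  qed
  have cP: "c n \<in> P" for n
    using c a0 unfolding c_def by (cases "\<exists>a\<in>P. n \<in> ?R a") auto
  have cell: "cell c a = a" if a: "a \<in> P" for a
  proof -
    \<comment> \<open>A point where the two sets differ is either uncovered or lies both in the
      representative of a and in that of a different colour \<open>c n\<close>.\<close>
    have sub: "(c -` {a} - ?R a) \<union> (?R a - c -` {a})
        \<subseteq> - (\<Union>a\<in>P. ?R a) \<union> (\<Union>a\<in>P. \<Union>b\<in>P - {a}. ?R a \<inter> ?R b)"
      (is "?l \<subseteq> ?r")
    proof
      fix n assume n: "n \<in> ?l"
      show "n \<in> ?r"
      proof (cases "\<exists>a\<in>P. n \<in> ?R a")
        case True
        then have "c n \<in> P" "n \<in> ?R (c n)" using c by auto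
        with n a show ?thesis by auto
      qed auto
    qed
    have "finite ?l" by (rule finite_subset[OF sub]) (use cof overlap in simp)
    then have "cell c a = abs_pow_mod_fin (?R a)"
      by (simp add: cell_def pow_mod_fin.abs_eq_iff eq_mod_fin_def)
    then show ?thesis by (simp add: abs_rep)
  qed
  have "recurrent c \<subseteq> P"
  proof
    fix x assume "x \<in> recurrent c"
    then have "c -` {x} \<noteq> {}" by (auto simp: recurrent_def)
    then show "x \<in> P" using cP by auto
  qed
  moreover have "P \<subseteq> recurrent c"
  proof
    fix a assume "a \<in> P"
    then have "cell c a \<noteq> bot" using cell nb by metis
    then show "a \<in> recurrent c" by (simp add: recurrent_def cell_def abs_eq_bot_iff)
  qed
  ultimately have "recurrent c = P" by (rule equalityI)
  moreover have "range c \<subseteq> P" using cP by blast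
  ultimately show ?thesis using cell that by blast
qed

lemma recurrent_unbounded:
  assumes "x \<in> recurrent c"
  obtains n where "n \<ge> N" "c n = x"
proof -
  have "\<exists>n\<ge>N. n \<in> c -` {x}"
    using assms unfolding recurrent_def infinite_nat_iff_unbounded_le by blast
  with that show ?thesis by auto
qed

lemma recurrent_step_unbounded:
  assumes "recurrent_step c x y"
  obtains n where "n \<ge> N" "c n = x" "c (Suc n) = y"
proof -
  have "\<exists>n\<ge>N. n \<in> {n. c n = x \<and> c (Suc n) = y}"
    using assms unfolding recurrent_step_def infinite_nat_iff_unbounded_le by blast
  with that show ?thesis by auto
qed

text \<open>Past N every step of the colouring is an arc. Starting from an occurrence of x past N
  and reading on to a later occurrence of y, which exists by recurrence, gives a walk from x to
  y.\<close>

lemma sc_digraph_colour: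
  assumes "finite (range c)"
  shows "sc_digraph (partition_digraph shift (colour_partition c))" (is "sc_digraph ?G")
proof -
  have fin: "finite (colour_partition c)"
    using finite_recurrent[OF assms] by simp
  obtain N where N: "\<And>n. n \<ge> N \<Longrightarrow> recurrent_step c (c n) (c (Suc n))"
    using eventually_recurrent_step[OF assms] by blast
  have "pair_fin_digraph ?G"
  proof
    show "finite (parcs ?G)"
      by (rule finite_subset[of _ "colour_partition c \<times> colour_partition c"])
        (use fin in \<open>auto simp: partition_digraph_def\<close>)
  qed (use fin in \<open>auto simp: partition_digraph_def\<close>)
  moreover have "strongly_connected (with_proj ?G)"
  proof
    show "verts (with_proj ?G) \<noteq> {}"
      using recurrent_step_in_recurrent[OF N[of N]] by (auto simp: partition_digraph_colour)
  next
    fix u v assume "u \<in> verts (with_proj ?G)" "v \<in> verts (with_proj ?G)"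
    then obtain x y where x: "x \<in> recurrent c" "u = cell c x" and y: "y \<in> recurrent c" "v = cell c y"
      by (auto simp: partition_digraph_colour)
    obtain n where n: "n \<ge> N" "c n = x"
      using recurrent_unbounded[OF x(1)] .
    obtain m where m: "m \<ge> n" "c m = y"
      using recurrent_unbounded[OF y(1)] .
    have "(cell c (c n), cell c (c m)) \<in> rtrancl_on (colour_partition c) (parcs ?G)"
      using m(1)
    proof (induction m rule: dec_induct)
      case base
      then show ?case using n x by auto
    next
      case (step k)
      have s: "recurrent_step c (c k) (c (Suc k))" using N n step by simp
      have "(cell c (c k), cell c (c (Suc k))) \<in> parcs ?G"
        using s by (auto simp: partition_digraph_colour)
      with step.IH recurrent_step_in_recurrent[OF s] show ?case
        by (auto intro: rtrancl_on_into_rtrancl_on)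
    qed
    then show "u \<rightarrow>\<^sup>*\<^bsub>with_proj ?G\<^esub> v"
      using n m x y by (simp add: reachable_def partition_digraph_colour(1))
  qed
  ultimately show ?thesis by (simp add: sc_digraph_def)
qed

section \<open>Natural maps between colour partitions\<close>

lemma natural_map_cell:
  assumes "x \<in> recurrent d" "y \<in> recurrent c" "cell d x \<le> cell c y"
  shows "natural_map (colour_partition c) (cell d x) = cell c y"
  unfolding natural_map_def
proof (rule the_equality)
  show "cell c y \<in> colour_partition c \<and> cell d x \<le> cell c y"
    using assms by blast
next
  fix z assume z: "z \<in> colour_partition c \<and> cell d x \<le> z"
  then obtain y' where y': "z = cell c y'" "y' \<in> recurrent c" by blast
  have "cell d x \<le> inf (cell c y') (cell c y)" using z y' assms by simp
  then have "inf (cell c y') (cell c y) \<noteq> bot"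
    using cell_neq_bot[OF assms(1)] bot.extremum_uniqueI by metis
  then show "z = cell c y" using y' inf_cell_eq_bot by metis
qed

lemma recurrent_factor:
  assumes "x \<in> recurrent d"
  shows "f x \<in> recurrent (f \<circ> d)" "cell d x \<le> cell (f \<circ> d) (f x)"
proof -
  have "d -` {x} \<subseteq> (f \<circ> d) -` {f x}" by auto
  then show "f x \<in> recurrent (f \<circ> d)"
    using assms unfolding recurrent_def by (auto dest: finite_subset)
  have "{n. d n = x \<and> (f \<circ> d) n \<noteq> f x} = {}" by auto
  then show "cell d x \<le> cell (f \<circ> d) (f x)"
    unfolding cell_le_iff by (metis finite.emptyI)
qed

lemma natural_map_factor:
  assumes "x \<in> recurrent d"
  shows "natural_map (colour_partition (f \<circ> d)) (cell d x) = cell (f \<circ> d) (f x)"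
  using natural_map_cell[OF assms recurrent_factor[OF assms]] .

lemma refines_factor: "refines (colour_partition d) (colour_partition (f \<circ> d))"
  unfolding refines_def using recurrent_factor[of _ d f] by blast

text \<open>For the forward direction, a recurrent step of the coarser colouring has an occurrence
  so late that the step of \<open>d\<close> there is itself recurrent. No pigeonhole over preimages
  is needed beyond the one in \<open>eventually_recurrent_step\<close>.\<close>

lemma recurrent_step_factor:
  assumes "finite (range d)"
  shows "recurrent_step (f \<circ> d) a b \<longleftrightarrow> (\<exists>x y. f x = a \<and> f y = b \<and> recurrent_step d x y)"
proof
  assume rs: "recurrent_step (f \<circ> d) a b"
  obtain N where N: "\<And>n. n \<ge> N \<Longrightarrow> recurrent_step d (d n) (d (Suc n))"
    using eventually_recurrent_step[OF assms] by blast
  obtain n where "n \<ge> N" "f (d n) = a" "f (d (Suc n)) = b"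
    using recurrent_step_unbounded[OF rs, of N] by auto
  with N show "\<exists>x y. f x = a \<and> f y = b \<and> recurrent_step d x y" by blast
next
  assume "\<exists>x y. f x = a \<and> f y = b \<and> recurrent_step d x y"
  then obtain x y where *: "f x = a" "f y = b" "infinite {n. d n = x \<and> d (Suc n) = y}"
    by (auto simp: recurrent_step_def)
  show "recurrent_step (f \<circ> d) a b"
    unfolding recurrent_step_def by (rule infinite_super[OF _ *(3)]) (use * in auto)
qed

lemma recurrent_has_successor:
  assumes "finite (range c)" "x \<in> recurrent c"
  obtains y where "recurrent_step c x y"
proof -
  obtain N where N: "\<And>n. n \<ge> N \<Longrightarrow> recurrent_step c (c n) (c (Suc n))"
    using eventually_recurrent_step[OF assms(1)] by blast
  obtain n where "n \<ge> N" "c n = x"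
    using recurrent_unbounded[OF assms(2)] .
  with N that show ?thesis by blast
qed

lemma epimorphism_factor:
  assumes fin: "finite (range d)"
  shows "epimorphism (natural_map (colour_partition (f \<circ> d)))
    (partition_digraph shift (colour_partition d))
    (partition_digraph shift (colour_partition (f \<circ> d)))"
    (is "epimorphism ?\<pi> ?G ?H")
proof -
  have finc: "finite (range (f \<circ> d))"
    using fin by (simp only: image_comp[symmetric] finite_imageI)
  have arcs: "(u, u') \<in> parcs ?H \<longleftrightarrow>
      (\<exists>v\<in>pverts ?G. \<exists>v'\<in>pverts ?G. ?\<pi> v = u \<and> ?\<pi> v' = u' \<and> (v, v') \<in> parcs ?G)" for u u'
  proof
    assume "(u, u') \<in> parcs ?H"
    then obtain a b where ab: "u = cell (f \<circ> d) a" "u' = cell (f \<circ> d) b" "recurrent_step (f \<circ> d) a b"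
      unfolding partition_digraph_colour by blast
    then obtain x y where xy: "f x = a" "f y = b" "recurrent_step d x y"
      using recurrent_step_factor[OF fin, of f a b] by blast
    note rec = recurrent_step_in_recurrent[OF xy(3)]
    have "(cell d x, cell d y) \<in> parcs ?G" using xy(3) unfolding partition_digraph_colour by blast
    moreover have "?\<pi> (cell d x) = u" "?\<pi> (cell d y) = u'"
      by (simp_all only: ab xy(1,2)[symmetric] rec[THEN natural_map_factor])
    ultimately show "\<exists>v\<in>pverts ?G. \<exists>v'\<in>pverts ?G. ?\<pi> v = u \<and> ?\<pi> v' = u' \<and> (v, v') \<in> parcs ?G"
      using rec unfolding partition_digraph_colour(1) by blast
  next
    assume "\<exists>v\<in>pverts ?G. \<exists>v'\<in>pverts ?G. ?\<pi> v = u \<and> ?\<pi> v' = u' \<and> (v, v') \<in> parcs ?G"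
    then obtain v v' where v: "?\<pi> v = u" "?\<pi> v' = u'" "(v, v') \<in> parcs ?G" by blast
    then obtain x y where xy: "v = cell d x" "v' = cell d y" "recurrent_step d x y"
      unfolding partition_digraph_colour by blast
    note rec = recurrent_step_in_recurrent[OF xy(3)]
    have "u = cell (f \<circ> d) (f x)" "u' = cell (f \<circ> d) (f y)"
      by (simp_all only: v(1,2)[symmetric] xy(1,2) rec[THEN natural_map_factor])
    moreover have "recurrent_step (f \<circ> d) (f x) (f y)"
      using recurrent_step_factor[OF fin, of f "f x" "f y"] xy(3) by blast
    ultimately show "(u, u') \<in> parcs ?H" unfolding partition_digraph_colour by blast
  qed
  moreover have "?\<pi> ` pverts ?G = pverts ?H"
  proof (intro equalityI subsetI)
    fix u assume "u \<in> ?\<pi> ` pverts ?G"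
    then obtain x where "x \<in> recurrent d" "u = ?\<pi> (cell d x)"
      unfolding partition_digraph_colour(1) by blast
    then show "u \<in> pverts ?H"
      using natural_map_factor[of x d f] recurrent_factor(1)[of x d f]
      unfolding partition_digraph_colour(1) by simp
  next
    fix u assume "u \<in> pverts ?H"
    then obtain a where a: "a \<in> recurrent (f \<circ> d)" "u = cell (f \<circ> d) a"
      unfolding partition_digraph_colour(1) by blast
    \<comment> \<open>Surjectivity on vertices is reduced to lifting arcs: each recurrent colour is
      the tail of some arc, and a lift of that arc provides a preimage.\<close>
    obtain b where "recurrent_step (f \<circ> d) a b"
      using recurrent_has_successor[OF finc a(1)] .
    then have "(u, cell (f \<circ> d) b) \<in> parcs ?H"
      using a unfolding partition_digraph_colour by blast
    then show "u \<in> ?\<pi> ` pverts ?G" unfolding arcs by blast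
  qed
  ultimately show ?thesis unfolding epimorphism_def by blast
qed

section \<open>Lifts of a colouring to walks in a digraph, and their concatenation\<close>

text \<open>A walk is a total function indexed by absolute positions, so concatenation is pasting of
  functions. Of each lift only its start, its set of traversed arcs and its end are kept; for finite
  V this leaves finitely many possible values, as Ramsey's theorem requires.\<close>

definition lifts :: "'v pair_pre_digraph \<Rightarrow> ('v \<Rightarrow> 'u) \<Rightarrow> (nat \<Rightarrow> 'u) \<Rightarrow> nat \<Rightarrow> nat \<Rightarrow>
    ('v \<times> ('v \<times> 'v) set \<times> 'v) set" where
  "lifts V \<phi> c i j = {(f i, (\<lambda>n. (f n, f (Suc n))) ` {i..<j}, f j) | f. range f \<subseteq> pverts V \<and>
     (\<forall>n\<in>{i..j}. \<phi> (f n) = c n) \<and> (\<forall>n\<in>{i..<j}. (f n, f (Suc n)) \<in> parcs V)}"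

text \<open>The lifts over an interval of length one, expressed by the two colours alone. Being
  independent of the position, they can be read off from an arc between states.\<close>

definition arc_lifts :: "'v pair_pre_digraph \<Rightarrow> ('v \<Rightarrow> 'u) \<Rightarrow> 'u \<Rightarrow> 'u \<Rightarrow>
    ('v \<times> ('v \<times> 'v) set \<times> 'v) set" where
  "arc_lifts V \<phi> a b = {(v, {(v, v')}, v') | v v'. (v, v') \<in> parcs V \<and> \<phi> v = a \<and> \<phi> v' = b}"

text \<open>Concatenation of walks with matching endpoints, carried over to sets of such triples;
  arc sets are united.\<close>

definition walk_product :: "('v \<times> 'e set \<times> 'v) set \<Rightarrow> ('v \<times> 'e set \<times> 'v) set \<Rightarrow>
    ('v \<times> 'e set \<times> 'v) set" where
  "walk_product A B = {(u, F \<union> G, w) | u F v G w. (u, F, v) \<in> A \<and> (v, G, w) \<in> B}"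

lemma walk_productI:
  "(u, F, v) \<in> A \<Longrightarrow> (v, G, w) \<in> B \<Longrightarrow> (u, F \<union> G, w) \<in> walk_product A B"
  by (auto simp: walk_product_def)

lemma walk_product_assoc:
  "walk_product (walk_product A B) C = walk_product A (walk_product B C)"
proof (intro equalityI subsetI)
  fix t assume "t \<in> walk_product (walk_product A B) C"
  then obtain u F v G w K x where "t = (u, (F \<union> G) \<union> K, x)" "(u, F, v) \<in> A" "(v, G, w) \<in> B" "(w, K, x) \<in> C"
    unfolding walk_product_def by blast
  then show "t \<in> walk_product A (walk_product B C)"
    by (simp add: Un_assoc walk_productI)
next
  fix t assume "t \<in> walk_product A (walk_product B C)"
  then obtain u F v G w K x where "t = (u, F \<union> (G \<union> K), x)" "(u, F, v) \<in> A" "(v, G, w) \<in> B" "(w, K, x) \<in> C"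
    unfolding walk_product_def by blast
  then show "t \<in> walk_product (walk_product A B) C"
    unfolding Un_assoc[symmetric] by (metis walk_productI)
qed

lemma lifts_subset: "lifts V \<phi> c i j \<subseteq> pverts V \<times> Pow (parcs V) \<times> pverts V"
  unfolding lifts_def by auto

lemma walk_product_lifts:
  assumes "i \<le> j" "j \<le> k"
  shows "walk_product (lifts V \<phi> c i j) (lifts V \<phi> c j k) = lifts V \<phi> c i k"
proof (intro equalityI subsetI)
  fix t assume "t \<in> walk_product (lifts V \<phi> c i j) (lifts V \<phi> c j k)"
  then obtain f g where t: "t = (f i, (\<lambda>n. (f n, f (Suc n))) ` {i..<j} \<union> (\<lambda>n. (g n, g (Suc n))) ` {j..<k}, g k)"
    and eq: "f j = g j"
    and f: "range f \<subseteq> pverts V" "\<forall>n\<in>{i..j}. \<phi> (f n) = c n" "\<forall>n\<in>{i..<j}. (f n, f (Suc n)) \<in> parcs V"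
    and g: "range g \<subseteq> pverts V" "\<forall>n\<in>{j..k}. \<phi> (g n) = c n" "\<forall>n\<in>{j..<k}. (g n, g (Suc n)) \<in> parcs V"
    unfolding walk_product_def lifts_def by auto
  \<comment> \<open>The two lifts agree at the common position j, so the pasted function follows
    \<open>f\<close> on {i..j} and \<open>g\<close> on {j..k}.\<close>
  define h where "h n = (if n \<le> j then f n else g n)" for n
  have hf: "h n = f n" if "n \<le> j" for n using that by (simp add: h_def)
  have hg: "h n = g n" if "n \<ge> j" for n using that eq by (auto simp: h_def)
  have "(\<lambda>n. (h n, h (Suc n))) ` {i..<k}
      = (\<lambda>n. (h n, h (Suc n))) ` {i..<j} \<union> (\<lambda>n. (h n, h (Suc n))) ` {j..<k}"
    using assms by (simp add: ivl_disj_un_two(3) flip: image_Un)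
  also have "\<dots> = (\<lambda>n. (f n, f (Suc n))) ` {i..<j} \<union> (\<lambda>n. (g n, g (Suc n))) ` {j..<k}"
    by (intro arg_cong2[where f = "(\<union>)"] image_cong) (simp_all add: hf hg)
  finally have "t = (h i, (\<lambda>n. (h n, h (Suc n))) ` {i..<k}, h k)"
    using t assms by (simp add: hf hg)
  moreover have "range h \<subseteq> pverts V" using f(1) g(1) by (auto simp: h_def)
  moreover have "\<phi> (h n) = c n" if "n \<in> {i..k}" for n
    using that f(2) g(2) by (simp add: h_def)
  moreover have "(h n, h (Suc n)) \<in> parcs V" if "n \<in> {i..<k}" for n
    using that f(3) g(3) by (cases "n < j") (simp_all add: hf hg)
  ultimately show "t \<in> lifts V \<phi> c i k" unfolding lifts_def by blast
next
  fix t assume "t \<in> lifts V \<phi> c i k"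
  then obtain f where t: "t = (f i, (\<lambda>n. (f n, f (Suc n))) ` {i..<k}, f k)"
    and f: "range f \<subseteq> pverts V" "\<forall>n\<in>{i..k}. \<phi> (f n) = c n" "\<forall>n\<in>{i..<k}. (f n, f (Suc n)) \<in> parcs V"
    unfolding lifts_def by blast
  have "(f i, (\<lambda>n. (f n, f (Suc n))) ` {i..<j}, f j) \<in> lifts V \<phi> c i j"
    unfolding lifts_def using f assms by auto
  moreover have "(f j, (\<lambda>n. (f n, f (Suc n))) ` {j..<k}, f k) \<in> lifts V \<phi> c j k"
    unfolding lifts_def using f assms by auto
  moreover have "{i..<k} = {i..<j} \<union> {j..<k}" using assms by auto
  ultimately show "t \<in> walk_product (lifts V \<phi> c i j) (lifts V \<phi> c j k)"
    using t by (simp add: image_Un walk_productI)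
qed

lemma lifts_Suc:
  assumes "pair_fin_digraph V"
  shows "lifts V \<phi> c n (Suc n) = arc_lifts V \<phi> (c n) (c (Suc n))"
proof (intro equalityI subsetI)
  fix t assume "t \<in> lifts V \<phi> c n (Suc n)"
  then show "t \<in> arc_lifts V \<phi> (c n) (c (Suc n))"
    unfolding lifts_def arc_lifts_def by auto
next
  fix t assume "t \<in> arc_lifts V \<phi> (c n) (c (Suc n))"
  then obtain v v' where t: "t = (v, {(v, v')}, v')" "(v, v') \<in> parcs V" "\<phi> v = c n" "\<phi> v' = c (Suc n)"
    unfolding arc_lifts_def by blast
  interpret pair_fin_digraph V by fact
  let ?f = "\<lambda>m. if m \<le> n then v else v'"
  have "range ?f \<subseteq> pverts V" using in_arcsD1[OF t(2)] in_arcsD2[OF t(2)] by auto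
  moreover have "t = (?f n, (\<lambda>m. (?f m, ?f (Suc m))) ` {n..<Suc n}, ?f (Suc n))" using t by simp
  ultimately show "t \<in> lifts V \<phi> c n (Suc n)"
    unfolding lifts_def using t by (intro CollectI exI[of _ ?f]) (auto simp: le_Suc_eq)
qed

section \<open>Ramsey's theorem for functions of increasing pairs\<close>

text \<open>\<open>Ramsey2\<close> colours unordered pairs by numbers below k. The values are
  therefore encoded as an initial segment of the naturals, and the order of a pair is recovered by
  \<open>Min\<close> and \<open>Max\<close>.\<close>

lemma Ramsey_pairs:
  fixes g :: "nat \<Rightarrow> nat \<Rightarrow> 'x"
  assumes "finite X" "\<And>i j. g i j \<in> X"
  obtains H e where "infinite H" "\<And>i j. i \<in> H \<Longrightarrow> j \<in> H \<Longrightarrow> i < j \<Longrightarrow> g i j = e"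
proof -
  obtain k and enc :: "'x \<Rightarrow> nat" where enc: "enc ` X = {i. i < k}" "inj_on enc X"
    using finite_imp_inj_to_nat_seg[OF assms(1)] by blast
  let ?f = "\<lambda>s. enc (g (Min s) (Max s))"
  have "\<forall>x\<in>UNIV. \<forall>y\<in>UNIV. x \<noteq> y \<longrightarrow> ?f {x, y} < k"
    using enc(1) assms(2) by blast
  from Ramsey2[OF infinite_UNIV_nat this] obtain H t where H: "infinite H"
    "\<forall>x\<in>H. \<forall>y\<in>H. x \<noteq> y \<longrightarrow> ?f {x, y} = t" by blast
  have "g i j = inv_into X enc t" if "i \<in> H" "j \<in> H" "i < j" for i j
  proof -
    have "enc (g (Min {i, j}) (Max {i, j})) = t" using H(2) that by (metis less_irrefl)
    then have "enc (g i j) = t" using that by (simp add: min_def max_def)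
    then show ?thesis using inv_into_f_f[OF enc(2) assms(2)] by metis
  qed
  with H(1) show ?thesis by (rule that)
qed

section \<open>Closed walks covering all arcs\<close>

text \<open>Walks from \<open>w0\<close>, remembered by their endpoint and their set of arcs. Growth
  at the end matches the way a lift is extended by one more colour, so invariants along the walk
  follow by rule induction.\<close>

inductive traversal :: "('w \<times> 'w) set \<Rightarrow> 'w \<Rightarrow> 'w \<Rightarrow> ('w \<times> 'w) set \<Rightarrow> bool" for A w0 where
  traversal_Nil: "traversal A w0 w0 {}"
| traversal_step: "traversal A w0 w F \<Longrightarrow> (w, w') \<in> A \<Longrightarrow> traversal A w0 w' (insert (w, w') F)"

lemma traversal_subset: "traversal A w0 w F \<Longrightarrow> F \<subseteq> A"
  by (induction rule: traversal.induct) auto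

lemma traversal_rtrancl_on:
  assumes "(w, w') \<in> rtrancl_on S A" "traversal A w0 w F"
  obtains F' where "F \<subseteq> F'" "traversal A w0 w' F'"
proof -
  have "\<exists>F'. F \<subseteq> F' \<and> traversal A w0 w' F'"
    using assms
  proof (induction rule: rtrancl_on_induct)
    case base
    then show ?case by blast
  next
    case (step y z)
    then obtain F' where "F \<subseteq> F'" "traversal A w0 y F'" by blast
    then show ?case using traversal_step[of A w0 y F' z] step.hyps by blast
  qed
  with that show ?thesis by blast
qed

text \<open>Arcs are collected one at a time: from \<open>w0\<close>, strong connectedness leads to
  the tail of the next arc, and after that arc back to \<open>w0\<close>.\<close>

lemma closed_covering_traversal:
  assumes "sc_digraph W" "w0 \<in> pverts W"
  shows "traversal (parcs W) w0 w0 (parcs W)"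
proof -
  interpret pair_fin_digraph W using assms(1) by (simp add: sc_digraph_def)
  have reach: "(u, v) \<in> rtrancl_on (pverts W) (parcs W)" if "u \<in> pverts W" "v \<in> pverts W" for u v
    using assms(1) that unfolding sc_digraph_def strongly_connected_def
    by (auto simp: reachable_def)
  have "\<exists>F. B \<subseteq> F \<and> traversal (parcs W) w0 w0 F" if "finite B" "B \<subseteq> parcs W" for B
    using that
  proof (induction B rule: finite_induct)
    case empty
    show ?case using traversal_Nil[of "parcs W" w0] by blast
  next
    case (insert b B)
    obtain x y where b: "b = (x, y)" "(x, y) \<in> parcs W" using insert.prems by (metis insert_subset surj_pair)
    have xy: "x \<in> pverts W" "y \<in> pverts W" using in_arcsD1[OF b(2)] in_arcsD2[OF b(2)] by auto
    obtain F where F: "B \<subseteq> F" "traversal (parcs W) w0 w0 F" using insert.IH insert.prems by blast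
    obtain F1 where F1: "F \<subseteq> F1" "traversal (parcs W) w0 x F1"
      using traversal_rtrancl_on[OF reach[OF assms(2) xy(1)] F(2)] .
    obtain F2 where "insert b F1 \<subseteq> F2" "traversal (parcs W) w0 w0 F2"
      using traversal_rtrancl_on[OF reach[OF xy(2) assms(2)] traversal_step[OF F1(2) b(2)]] b(1) by metis
    then show ?case using F F1 by blast
  qed
  then obtain F where "parcs W \<subseteq> F" "traversal (parcs W) w0 w0 F"
    using pair_finite_arcs by blast
  with traversal_subset show ?thesis by (metis subset_antisym)
qed

section \<open>Realizing a virtual refinement by a colouring\<close>

text \<open>The isomorphism is \<open>cell d\<close>. Positions before N, where \<open>d\<close> may
  fail to lift \<open>c\<close>, disappear modulo finite sets, so each cell of \<open>d\<close> lies
  below the cell of the image colour.\<close>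

lemma realizes_colouring:
  assumes fin: "finite (range d)" and d: "recurrent d = pverts V"
    and arcs: "\<And>v v'. recurrent_step d v v' \<longleftrightarrow> (v, v') \<in> parcs V"
    and \<phi>: "\<phi> ` pverts V \<subseteq> recurrent c"
    and lift: "\<And>n. n \<ge> N \<Longrightarrow> \<phi> (d n) = c n"
    and c: "\<And>a. a \<in> recurrent c \<Longrightarrow> cell c a = a"
  shows "realizes shift (colour_partition d) (colour_partition c) \<phi> V"
proof -
  have le: "cell d v \<le> cell c (\<phi> v)" for v
    unfolding cell_le_iff
  proof (rule finite_subset)
    show "{n. d n = v \<and> c n \<noteq> \<phi> v} \<subseteq> {..<N}"
    proof
      fix n assume "n \<in> {n. d n = v \<and> c n \<noteq> \<phi> v}"
      then have "\<not> n \<ge> N" using lift by auto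
      then show "n \<in> {..<N}" by simp
    qed
  qed simp
  have nat: "natural_map (colour_partition c) (cell d v) = \<phi> v" if "v \<in> pverts V" for v
  proof -
    have "\<phi> v \<in> recurrent c" using \<phi> that by blast
    with natural_map_cell[OF _ this le[of v]] that d c show ?thesis by simp
  qed
  have ref: "refines (colour_partition d) (colour_partition c)"
    unfolding refines_def
  proof
    fix x assume "x \<in> colour_partition d"
    then obtain v where "v \<in> pverts V" "x = cell d v" using d by blast
    with le[of v] \<phi> show "\<exists>y\<in>colour_partition c. x \<le> y" by blast
  qed
  have "bij_betw (cell d) (pverts V) (pverts (partition_digraph shift (colour_partition d)))"
    unfolding bij_betw_def partition_digraph_colour(1) using inj_on_cell[of d] d by simp
  moreover have "(v, v') \<in> parcs V \<longleftrightarrow>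
      (cell d v, cell d v') \<in> parcs (partition_digraph shift (colour_partition d))"
    if "v \<in> pverts V" "v' \<in> pverts V" for v v'
    using cell_arc_iff[of v d v'] that unfolding d arcs by blast
  ultimately have "digraph_isomorphism_map (cell d) V (partition_digraph shift (colour_partition d))"
    unfolding digraph_isomorphism_map_def by blast
  with nat ref is_partition_colour[OF fin] show ?thesis
    unfolding realizes_def by blast
qed

text \<open>An arc is supplied because a single vertex without arcs is strongly connected. A walk
  from the head b to x either is empty, and then a precedes x, or has a last arc into x.\<close>

lemma sc_digraph_in_arc:
  assumes "sc_digraph V" "(a, b) \<in> parcs V" "x \<in> pverts V"
  obtains y where "(y, x) \<in> parcs V"
proof -
  interpret pair_fin_digraph V using assms(1) by (simp add: sc_digraph_def)
  have "b \<in> pverts V" using in_arcsD2[OF assms(2)] .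
  then have "(b, x) \<in> rtrancl_on (pverts V) (parcs V)"
    using assms(1,3) unfolding sc_digraph_def strongly_connected_def by (auto simp: reachable_def)
  then show ?thesis
  proof (cases rule: rtrancl_on.cases)
    case rtrancl_on_refl
    then show ?thesis using assms(2) that by blast
  next
    case (rtrancl_on_into_rtrancl_on y)
    then show ?thesis using that by blast
  qed
qed

text \<open>Between consecutive marks a closed lift at v through all arcs is chosen. All of them
  start and end at v, so they fit together into one walk that meets every arc in every
  block.\<close>

lemma lifting_of_loops:
  assumes "infinite H" "v \<in> pverts V"
    and loop: "\<And>h h'. h \<in> H \<Longrightarrow> h' \<in> H \<Longrightarrow> h < h' \<Longrightarrow> (v, parcs V, v) \<in> lifts V \<phi> c h h'"
  obtains d N where "range d \<subseteq> pverts V" "\<And>n. n \<ge> N \<Longrightarrow> \<phi> (d n) = c n"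
    "\<And>n. n \<ge> N \<Longrightarrow> (d n, d (Suc n)) \<in> parcs V"
    "\<And>x y m. (x, y) \<in> parcs V \<Longrightarrow> \<exists>n\<ge>m. d n = x \<and> d (Suc n) = y"
proof -
  let ?r = "enumerate H"
  have less: "?r k < ?r (Suc k)" for k using enumerate_step[OF assms(1)] .
  have mono: "?r j \<le> ?r k" if "j \<le> k" for j k
    using lift_Suc_mono_le[of ?r j k] less that by (simp add: less_imp_le)
  have ge: "k \<le> ?r k" for k using le_enumerate[OF assms(1)] .
  define good where "good k f \<longleftrightarrow> range f \<subseteq> pverts V \<and> f (?r k) = v \<and> f (?r (Suc k)) = v \<and>
      (\<forall>n\<in>{?r k..?r (Suc k)}. \<phi> (f n) = c n) \<and>
      (\<lambda>n. (f n, f (Suc n))) ` {?r k..<?r (Suc k)} = parcs V" for k f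
  have "\<forall>k. \<exists>f. good k f"
  proof
    fix k
    have "(v, parcs V, v) \<in> lifts V \<phi> c (?r k) (?r (Suc k))"
      using loop[OF _ _ less] assms(1) by (simp add: enumerate_in_set)
    then obtain f where "(v, parcs V, v)
        = (f (?r k), (\<lambda>n. (f n, f (Suc n))) ` {?r k..<?r (Suc k)}, f (?r (Suc k)))"
      "range f \<subseteq> pverts V" "\<forall>n\<in>{?r k..?r (Suc k)}. \<phi> (f n) = c n"
      unfolding lifts_def by blast
    then have "good k f"
      unfolding good_def prod.inject by (elim conjE, intro conjI) (assumption | rule sym, assumption)+
    then show "\<exists>f. good k f" by blast
  qed
  then obtain f where "\<forall>k. good k (f k)" by (rule choice[THEN exE])
  then have f: "range (f k) \<subseteq> pverts V" "f k (?r k) = v" "f k (?r (Suc k)) = v"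
      "n \<in> {?r k..?r (Suc k)} \<Longrightarrow> \<phi> (f k n) = c n"
      "(\<lambda>n. (f k n, f k (Suc n))) ` {?r k..<?r (Suc k)} = parcs V" for k n
    unfolding good_def by blast+
  \<comment> \<open>\<open>b n\<close> is the index of the block containing n; positions before the
    first mark get index 0.\<close>
  define b where "b n = (LEAST k. n < ?r (Suc k))" for n
  define d where "d n = f (b n) n" for n
  have b_eq: "b n = k" if "?r k \<le> n" "n < ?r (Suc k)" for n k
    unfolding b_def
  proof (rule Least_equality)
    fix j assume "n < ?r (Suc j)"
    show "k \<le> j"
    proof (rule ccontr)
      assume "\<not> k \<le> j"
      then have "?r (Suc j) \<le> ?r k" by (intro mono) simp
      with \<open>n < ?r (Suc j)\<close> that show False by simp
    qed
  qed fact
  have block: "\<exists>k. ?r k \<le> n \<and> n < ?r (Suc k)" if "?r 0 \<le> n" for n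
  proof -
    have ex: "n < ?r (Suc n)" using ge[of "Suc n"] by simp
    have "n < ?r (Suc (b n))" unfolding b_def by (rule LeastI[where P = "\<lambda>k. n < ?r (Suc k)", OF ex])
    moreover have "?r (b n) \<le> n"
    proof (cases "b n")
      case 0
      then show ?thesis using that by simp
    next
      case (Suc k)
      then have "k < b n" by simp
      then have "\<not> n < ?r (Suc k)" unfolding b_def by (rule not_less_Least)
      with Suc show ?thesis by simp
    qed
    ultimately show ?thesis by blast
  qed
  \<comment> \<open>The right endpoint belongs to the next block, but both choices have the value v
    there. Including it lets the last arc of a block be read off from \<open>f k\<close>.\<close>
  have d_eq: "d n = f k n" if "?r k \<le> n" "n \<le> ?r (Suc k)" for n k
  proof (cases "n = ?r (Suc k)")
    case True
    then have "b n = Suc k" using b_eq[of "Suc k" n] less[of "Suc k"] by simp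
    then show ?thesis using True f(2)[of "Suc k"] f(3)[of k] by (simp add: d_def)
  next
    case False
    then show ?thesis using b_eq[of k n] that by (simp add: d_def)
  qed
  show ?thesis
  proof (rule that[of d "?r 0"])
    show "range d \<subseteq> pverts V" using f(1) unfolding d_def by blast
  next
    fix n assume "?r 0 \<le> n"
    then obtain k where k: "?r k \<le> n" "n < ?r (Suc k)" using block by blast
    then show "\<phi> (d n) = c n" using d_eq[of k n] f(4)[of n k] by simp
    have "(f k n, f k (Suc n)) \<in> (\<lambda>n. (f k n, f k (Suc n))) ` {?r k..<?r (Suc k)}"
      using k by (intro image_eqI[of _ _ n]) auto
    then have "(f k n, f k (Suc n)) \<in> parcs V" unfolding f(5) .
    then show "(d n, d (Suc n)) \<in> parcs V" using k d_eq[of k n] d_eq[of k "Suc n"] by simp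
  next
    fix x y m assume "(x, y) \<in> parcs V"
    then have "(x, y) \<in> (\<lambda>n. (f m n, f m (Suc n))) ` {?r m..<?r (Suc m)}" unfolding f(5) .
    then obtain n where n: "?r m \<le> n" "n < ?r (Suc m)" "x = f m n" "y = f m (Suc n)" by auto
    then have "d n = x" "d (Suc n) = y" using d_eq[of m n] d_eq[of m "Suc n"] by simp_all
    moreover have "m \<le> n" using ge[of m] n(1) by simp
    ultimately show "\<exists>n\<ge>m. d n = x \<and> d (Suc n) = y" by blast
  qed
qed

text \<open>The glued walk eventually uses only arcs of V and uses each of them infinitely often, so
  its recurrent steps are exactly the arcs of V.\<close>

lemma realizes_of_loops:
  fixes V :: "'v pair_pre_digraph"
  assumes V: "sc_digraph V" and "infinite H"
    and loop: "\<And>h h'. h \<in> H \<Longrightarrow> h' \<in> H \<Longrightarrow> h < h' \<Longrightarrow> (v, parcs V, v) \<in> lifts V \<phi> c h h'"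
    and \<phi>: "\<phi> ` pverts V \<subseteq> recurrent c"
    and c: "\<And>a. a \<in> recurrent c \<Longrightarrow> cell c a = a"
  obtains d :: "nat \<Rightarrow> 'v" where "realizes shift (colour_partition d) (colour_partition c) \<phi> V"
proof -
  interpret pair_fin_digraph V using V by (simp add: sc_digraph_def)
  obtain h where h: "h \<in> H" using assms(2) by fastforce
  obtain h' where h': "h' \<in> H" "h < h'" using assms(2) unfolding infinite_nat_iff_unbounded by blast
  have "v \<in> pverts V" using loop[OF h h'] lifts_subset[of V \<phi> c h h'] by blast
  from lifting_of_loops[OF assms(2) this loop] obtain d N where d: "range d \<subseteq> pverts V"
    "\<And>n. n \<ge> N \<Longrightarrow> \<phi> (d n) = c n" "\<And>n. n \<ge> N \<Longrightarrow> (d n, d (Suc n)) \<in> parcs V"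
    "\<And>x y m. (x, y) \<in> parcs V \<Longrightarrow> \<exists>n\<ge>m. d n = x \<and> d (Suc n) = y" by blast
  have fin: "finite (range d)" using d(1) pair_finite_verts finite_subset by blast
  have step: "recurrent_step d x y \<longleftrightarrow> (x, y) \<in> parcs V" for x y
  proof
    assume rs: "recurrent_step d x y"
    obtain n where "n \<ge> N" "d n = x" "d (Suc n) = y" using recurrent_step_unbounded[OF rs] .
    then show "(x, y) \<in> parcs V" using d(3) by blast
  next
    assume "(x, y) \<in> parcs V"
    then show "recurrent_step d x y"
      using d(4) unfolding recurrent_step_def infinite_nat_iff_unbounded_le by blast
  qed
  have "recurrent d = pverts V"
  proof (intro equalityI subsetI)
    fix x assume "x \<in> recurrent d"
    then obtain n where "d n = x" using recurrent_unbounded[of x d 0] by blast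
    then show "x \<in> pverts V" using d(1) by blast
  next
    fix x assume "x \<in> pverts V"
    \<comment> \<open>The step of \<open>d\<close> at position N is the arc that
      \<open>sc_digraph_in_arc\<close> asks for.\<close>
    then obtain y where "(y, x) \<in> parcs V" using sc_digraph_in_arc[OF V d(3)[OF order.refl]] by blast
    then show "x \<in> recurrent d" unfolding step[symmetric] by (rule recurrent_step_in_recurrent)
  qed
  with step d(2) have "realizes shift (colour_partition d) (colour_partition c) \<phi> V"
    by (intro realizes_colouring[OF fin _ _ \<phi> _ c])
  then show ?thesis by (rule that)
qed

section \<open>Compatibility forces a covering loop\<close>

text \<open>A state \<open>(a, Q, marked)\<close> of \<open>c'\<close> carries in \<open>Q\<close> all lifts of the colours seen since the
  previous mark. Along a closed walk in \<open>W\<close> that covers every arc, the projection to \<open>V\<close> is a single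
  walk, which always lies in \<open>Q\<close> or in \<open>e Q\<close> for the current state.\<close>

lemma compatible_imp_covering_loop:
  fixes c' :: "nat \<Rightarrow> pow_mod_fin \<times> ('v \<times> ('v \<times> 'v) set \<times> 'v) set \<times> bool"
  assumes V: "sc_digraph V" and ne: "parcs V \<noteq> {}"
    and c: "\<And>a. a \<in> recurrent c \<Longrightarrow> cell c a = a" "fst \<circ> c' = c"
    and step: "\<And>a Q m a' Q' m'. recurrent_step c' (a, Q, m) (a', Q', m') \<Longrightarrow>
      Q' = (if m then arc_lifts V \<phi> a a' else walk_product Q (arc_lifts V \<phi> a a'))"
    and mark: "\<And>a Q. (a, Q, True) \<in> recurrent c' \<Longrightarrow> Q = e"
    and idem: "walk_product e e = e"
    and x0: "(a0, Q0, True) \<in> recurrent c'"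
    and compat: "compatible_epis (natural_map (colour_partition c))
      (partition_digraph shift (colour_partition c')) \<phi> V"
  obtains v where "(v, parcs V, v) \<in> e"
proof -
  let ?G = "partition_digraph shift (colour_partition c')"
  obtain W :: "nat pair_pre_digraph" and \<phi>' \<psi>' where W: "sc_digraph W"
    and \<phi>': "epimorphism \<phi>' W ?G" and \<psi>': "epimorphism \<psi>' W V"
    and comm: "\<And>w. w \<in> pverts W \<Longrightarrow> natural_map (colour_partition c) (\<phi>' w) = \<phi> (\<psi>' w)"
    using compat unfolding compatible_epis_def by blast
  interpret W: pair_fin_digraph W using W by (simp add: sc_digraph_def)
  interpret V: pair_fin_digraph V using V by (simp add: sc_digraph_def)
  have im\<phi>: "\<phi>' ` pverts W = colour_partition c'"
    using \<phi>' unfolding epimorphism_def partition_digraph_colour(1) by blast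
  \<comment> \<open>Vertices of the partition digraph are cells; since \<open>cell\<close> is
    injective on recurrent colours, each vertex of \<open>W\<close> determines a state of
    \<open>c'\<close>.\<close>
  define state where "state w = inv_into (recurrent c') (cell c') (\<phi>' w)" for w
  have state: "state w \<in> recurrent c'" "cell c' (state w) = \<phi>' w" if "w \<in> pverts W" for w
  proof -
    have "\<phi>' w \<in> colour_partition c'" using im\<phi> that by blast
    then show "state w \<in> recurrent c'" "cell c' (state w) = \<phi>' w"
      unfolding state_def by (rule inv_into_into, rule f_inv_into_f)
  qed
  have state_step: "recurrent_step c' (state w) (state w')" if "(w, w') \<in> parcs W" for w w'
  proof -
    have w: "w \<in> pverts W" "w' \<in> pverts W" using that W.in_arcsD1 W.in_arcsD2 by blast+
    then have "(\<phi>' w, \<phi>' w') \<in> parcs ?G" using \<phi>' that unfolding epimorphism_def by blast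
    then show ?thesis using cell_arc_iff[of "state w" c' "state w'"] state w by simp
  qed
  have \<psi>_arc: "(\<psi>' w, \<psi>' w') \<in> parcs V" if "(w, w') \<in> parcs W" for w w'
  proof -
    have "w \<in> pverts W" "w' \<in> pverts W" using that W.in_arcsD1 W.in_arcsD2 by blast+
    then show ?thesis using \<psi>' that unfolding epimorphism_def by blast
  qed
  \<comment> \<open>Epimorphisms hit every arc, so a covering walk of \<open>W\<close> projects to a
    covering walk of \<open>V\<close>.\<close>
  have \<psi>_covers: "map_prod \<psi>' \<psi>' ` parcs W = parcs V"
  proof (intro equalityI subsetI)
    fix z assume "z \<in> map_prod \<psi>' \<psi>' ` parcs W"
    then show "z \<in> parcs V" using \<psi>_arc by auto
  next
    fix z assume z: "z \<in> parcs V"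
    obtain u u' where u: "z = (u, u')" by fastforce
    then have "u \<in> pverts V" "u' \<in> pverts V" using z V.in_arcsD1 V.in_arcsD2 by blast+
    then obtain w w' where "\<psi>' w = u" "\<psi>' w' = u'" "(w, w') \<in> parcs W"
      using \<psi>' z u unfolding epimorphism_def by blast
    then show "z \<in> map_prod \<psi>' \<psi>' ` parcs W" unfolding u by (intro image_eqI[of _ _ "(w, w')"]) simp_all
  qed
  \<comment> \<open>By commutativity of the square, the projection to \<open>V\<close> lifts the
    colours read from the states.\<close>
  have colour: "\<phi> (\<psi>' w) = fst (state w)" if w: "w \<in> pverts W" for w
  proof -
    have "natural_map (colour_partition (fst \<circ> c')) (cell c' (state w)) = cell (fst \<circ> c') (fst (state w))"
      using natural_map_factor[OF state(1)[OF w], of fst] .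
    moreover have "fst (state w) \<in> recurrent c"
      using recurrent_factor(1)[OF state(1)[OF w], of fst] unfolding c(2) .
    ultimately show ?thesis using comm[OF w] state(2)[OF w] c by simp
  qed
  obtain w0 where w0: "w0 \<in> pverts W" "\<phi>' w0 = cell c' (a0, Q0, True)"
    using im\<phi> x0 by (metis (no_types, lifting) imageE image_eqI)
  have s0: "state w0 = (a0, Q0, True)"
    unfolding state_def w0(2) by (rule inv_into_f_f[OF inj_on_cell x0])
  have Q0: "Q0 = e" using mark x0 by blast
  \<comment> \<open>The walk lies in \<open>Q\<close> as long as no mark has been left since the
    first step; once one has, the part up to the last mark left is absorbed into \<open>e\<close>,
    giving \<open>walk_product e Q\<close>. The empty walk is listed separately because nothing puts
    it into the set stored at \<open>w0\<close>.\<close>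
  have "(w = w0 \<and> F = {}) \<or> (let Q = fst (snd (state w)) in
      (\<psi>' w0, map_prod \<psi>' \<psi>' ` F, \<psi>' w) \<in> Q \<union> walk_product e Q)"
    if "traversal (parcs W) w0 w F" for w F
    using that
  proof (induction rule: traversal.induct)
    case traversal_Nil
    then show ?case by simp
  next
    case (traversal_step w F w')
    let ?F = "map_prod \<psi>' \<psi>' ` F"
    have w: "w \<in> pverts W" "w' \<in> pverts W"
      using traversal_step.hyps(2) W.in_arcsD1 W.in_arcsD2 by blast+
    obtain a Q m where s: "state w = (a, Q, m)" by (metis surj_pair)
    obtain a' Q' m' where s': "state w' = (a', Q', m')" by (metis surj_pair)
    let ?S = "arc_lifts V \<phi> a a'"
    have Q': "Q' = (if m then ?S else walk_product Q ?S)"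
      using step state_step[OF traversal_step.hyps(2)] unfolding s s' by blast
    have new: "(\<psi>' w, {(\<psi>' w, \<psi>' w')}, \<psi>' w') \<in> ?S"
      using \<psi>_arc[OF traversal_step.hyps(2)] colour[OF w(1)] colour[OF w(2)] s s'
      unfolding arc_lifts_def by auto
    have ext: "(\<psi>' w0, map_prod \<psi>' \<psi>' ` insert (w, w') F, \<psi>' w') \<in> walk_product A ?S"
      if "(\<psi>' w0, ?F, \<psi>' w) \<in> A" for A
      using walk_productI[OF that new] by (simp add: Un_commute)
    show ?case
    proof (cases "w = w0 \<and> F = {}")
      case True
      \<comment> \<open>The walk starts at a marked state, so its first step resets the stored set
        to the lifts of that single step.\<close>
      then have "m" using s s0 by simp
      with True new Q' s' show ?thesis by simp
    next
      case False
      then have old: "(\<psi>' w0, ?F, \<psi>' w) \<in> Q \<union> walk_product e Q"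
        using traversal_step.IH unfolding s Let_def by auto
      show ?thesis
      proof (cases m)
        case True
        \<comment> \<open>At a mark both alternatives collapse to \<open>e\<close> by idempotence.
          The stored set restarts with \<open>?S\<close>, and the extended walk lies in the product
          of \<open>e\<close> with it.\<close>
        then have "Q = e" using mark state(1)[OF w(1)] s by metis
        with old idem have "(\<psi>' w0, ?F, \<psi>' w) \<in> e" by simp
        from ext[OF this] True Q' s' show ?thesis by simp
      next
        case False
        then have "Q' = walk_product Q ?S" using Q' by simp
        with old ext[of Q] ext[of "walk_product e Q"] s' show ?thesis
          by (auto simp: walk_product_assoc)
      qed
    qed
  qed
  \<comment> \<open>The covering walk ends at \<open>w0\<close>, where the stored set is
    \<open>e\<close>, so idempotence merges the alternatives. The empty walk is excluded since
    \<open>V\<close> has an arc.\<close>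
  from this[OF closed_covering_traversal[OF W w0(1)]]
  have "(\<psi>' w0, parcs V, \<psi>' w0) \<in> e"
    using ne idem \<psi>_covers s0 Q0 by (auto simp: Let_def)
  then show ?thesis by (rule that)
qed

section \<open>The colouring refined by marks, and the dichotomy\<close>

text \<open>The maximum runs over marks strictly before n. At a mark the recorded interval thus
  still reaches back to the previous mark, and the restart shows only one position later.\<close>

lemma last_mark:
  fixes H :: "nat set"
  assumes "h \<in> H" "h < n"
  defines "p \<equiv> \<lambda>n. Max {h \<in> H. h < n}"
  shows "p n \<in> H" "p n < n" "p (Suc n) = (if n \<in> H then n else p n)"
proof -
  have "p n \<in> {h \<in> H. h < n}" unfolding p_def using assms(1,2) by (intro Max_in) auto
  then show "p n \<in> H" "p n < n" by auto
  show "p (Suc n) = (if n \<in> H then n else p n)"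
  proof (cases "n \<in> H")
    case True
    then have "p (Suc n) = n" unfolding p_def by (intro Max_eqI) auto
    with True show ?thesis by simp
  next
    case False
    then have "{h \<in> H. h < Suc n} = {h \<in> H. h < n}" by (auto simp: less_Suc_eq)
    with False show ?thesis by (simp add: p_def)
  qed
qed

theorem theorem11p2:
  shows "polarized_system TYPE('v) shift"
  unfolding polarized_system_def
proof (intro conjI allI impI)
  show "boolean_automorphism shift" by (rule boolean_automorphism_shift)
next
  fix P and \<phi> :: "'v \<Rightarrow> pow_mod_fin" and V
  assume P: "is_partition P" and vr: "virtual_refinement shift P \<phi> V"
  have V: "sc_digraph V" and \<phi>: "epimorphism \<phi> V (partition_digraph shift P)"
    using vr by (simp_all add: virtual_refinement_def)
  interpret pair_fin_digraph V using V by (simp add: sc_digraph_def)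
  obtain c where c: "range c \<subseteq> P" "recurrent c = P" "\<And>a. a \<in> P \<Longrightarrow> cell c a = a"
    using partition_colouring[OF P] by blast
  have P_eq: "colour_partition c = P" using c by simp
  have "finite P" using P by (simp add: is_partition_def)
  then have finc: "finite (range c)" using c(1) by (rule finite_subset[rotated])
  have \<phi>_im: "\<phi> ` pverts V \<subseteq> recurrent c"
    using \<phi> c(2) by (simp add: epimorphism_def partition_digraph_def)
  have finX: "finite (Pow (pverts V \<times> Pow (parcs V) \<times> pverts V))"
    using pair_finite_verts pair_finite_arcs by simp
  obtain H e where H: "infinite H"
    and e: "\<And>i j. i \<in> H \<Longrightarrow> j \<in> H \<Longrightarrow> i < j \<Longrightarrow> lifts V \<phi> c i j = e"
    using Ramsey_pairs[OF finX, of "lifts V \<phi> c"] lifts_subset by (metis PowI)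
  show "polarized_refinement shift P \<phi> V"
  proof (cases "\<exists>v. (v, parcs V, v) \<in> e")
    case True
    then obtain v where "(v, parcs V, v) \<in> e" by blast
    then have "(v, parcs V, v) \<in> lifts V \<phi> c h h'" if "h \<in> H" "h' \<in> H" "h < h'" for h h'
      using e that by simp
    from realizes_of_loops[OF V H this \<phi>_im c(3)[folded c(2)]]
    obtain d :: "nat \<Rightarrow> 'v" where "realizes shift (colour_partition d) P \<phi> V" unfolding P_eq by blast
    then show ?thesis unfolding polarized_refinement_def by blast
  next
    case False
    obtain h0 where h0: "h0 \<in> H" using H by fastforce
    obtain h1 where h1: "h1 \<in> H" "h0 < h1" using H unfolding infinite_nat_iff_unbounded by blast
    obtain h2 where h2: "h2 \<in> H" "h1 < h2" using H unfolding infinite_nat_iff_unbounded by blast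
    \<comment> \<open>Three marks suffice: the lifts over the two inner intervals and over the whole
      interval are all \<open>e\<close>, and they multiply.\<close>
    have idem: "walk_product e e = e"
      using walk_product_lifts[of h0 h1 h2 V \<phi> c] e[OF h0 h1] e[OF h1(1) h2] e[OF h0 h2(1)] h1 h2
      by simp
    define p where "p n = Max {h \<in> H. h < n}" for n
    \<comment> \<open>From \<open>Suc h0\<close> on there is a mark strictly before n. Earlier
      values of \<open>p\<close> are arbitrary, but recurrent states and steps also occur later than
      that.\<close>
    have p: "p n \<in> H" "p n < n" "p (Suc n) = (if n \<in> H then n else p n)" if "n \<ge> Suc h0" for n
      using last_mark[OF h0, of n] that unfolding p_def by simp_all
    \<comment> \<open>The refined colour adds the lifts since the last mark and a flag for marks.
      Finiteness of V keeps the number of colours finite.\<close>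
    define c' where "c' n = (c n, lifts V \<phi> c (p n) n, n \<in> H)" for n
    have fst_c': "fst \<circ> c' = c" by (auto simp: c'_def)
    have "range c' \<subseteq> range c \<times> Pow (pverts V \<times> Pow (parcs V) \<times> pverts V) \<times> UNIV"
      using lifts_subset[of V \<phi> c] unfolding c'_def by blast
    then have fin: "finite (range c')"
      by (rule finite_subset) (intro finite_cartesian_product finc finX finite)
    have step: "Q' = (if m then arc_lifts V \<phi> a a' else walk_product Q (arc_lifts V \<phi> a a'))"
      if rs: "recurrent_step c' (a, Q, m) (a', Q', m')" for a Q m a' Q' m'
    proof -
      obtain n where n: "n \<ge> Suc h0" "c' n = (a, Q, m)" "c' (Suc n) = (a', Q', m')"
        using recurrent_step_unbounded[OF rs] .
      have S: "lifts V \<phi> c n (Suc n) = arc_lifts V \<phi> a a'"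
        using lifts_Suc[of V \<phi> c n] n pair_fin_digraph_axioms by (simp add: c'_def)
      have "walk_product (lifts V \<phi> c (p n) n) (lifts V \<phi> c n (Suc n)) = lifts V \<phi> c (p n) (Suc n)"
        using p(2)[OF n(1)] by (intro walk_product_lifts) simp_all
      then show ?thesis using n p(3)[OF n(1)] S by (auto simp: c'_def)
    qed
    have mark: "Q = e" if rec: "(a, Q, True) \<in> recurrent c'" for a Q
    proof -
      obtain n where n: "n \<ge> Suc h0" "c' n = (a, Q, True)" using recurrent_unbounded[OF rec] .
      \<comment> \<open>A marked position n and \<open>p n\<close> are two marks, between which the
        lifts are \<open>e\<close>.\<close>
      then show ?thesis using e[OF p(1) _ p(2)] by (auto simp: c'_def)
    qed
    obtain N where N: "\<And>n. n \<ge> N \<Longrightarrow> infinite (c' -` {c' n})"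
      using pigeonhole_eventually[OF fin] by blast
    \<comment> \<open>A mark past N has a recurrent state, which provides the marked starting
      state.\<close>
    obtain h where h: "h \<in> H" "h \<ge> N" using H unfolding infinite_nat_iff_unbounded_le by blast
    have "c' h \<in> recurrent c'" using N[OF h(2)] by (simp add: recurrent_def)
    then have x0: "(c h, lifts V \<phi> c (p h) h, True) \<in> recurrent c'" using h(1) by (simp add: c'_def)
    \<comment> \<open>The recurrent colour at h has a successor, so the digraph of P has an arc, and
      the epimorphism \<open>\<phi>\<close> lifts it to V.\<close>
    have "parcs V \<noteq> {}"
    proof -
      obtain b where "recurrent_step c (c h) b"
        using recurrent_has_successor[OF finc, of "c h"] recurrent_factor(1)[OF x0, of fst]
        unfolding fst_c' by auto
      then have "(cell c (c h), cell c b) \<in> parcs (partition_digraph shift P)"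
        unfolding P_eq[symmetric] partition_digraph_colour by blast
      moreover from this have "cell c (c h) \<in> pverts (partition_digraph shift P)"
          "cell c b \<in> pverts (partition_digraph shift P)"
        by (simp_all add: partition_digraph_def)
      ultimately show ?thesis using \<phi> unfolding epimorphism_def by blast
    qed
    have "\<not> compatible_epis (natural_map P) (partition_digraph shift (colour_partition c')) \<phi> V"
    proof
      assume compat: "compatible_epis (natural_map P) (partition_digraph shift (colour_partition c')) \<phi> V"
      show False
      proof (rule compatible_imp_covering_loop[OF V \<open>parcs V \<noteq> {}\<close> _ fst_c' _ _ idem x0])
        show "cell c a = a" if "a \<in> recurrent c" for a using c that by simp
        show "compatible_epis (natural_map (colour_partition c))
            (partition_digraph shift (colour_partition c')) \<phi> V"
          unfolding P_eq by (rule compat)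
        show False if "(v, parcs V, v) \<in> e" for v using False that by blast
      qed (fact step, fact mark)
    qed
    moreover have "epimorphism (natural_map P) (partition_digraph shift (colour_partition c'))
        (partition_digraph shift P)"
      using epimorphism_factor[OF fin, of fst] unfolding fst_c' P_eq .
    moreover have "refines (colour_partition c') P"
      using refines_factor[of c' fst] unfolding fst_c' P_eq .
    ultimately show ?thesis
      using V \<phi> is_partition_colour[OF fin] sc_digraph_colour[OF fin]
      unfolding polarized_refinement_def incompatible_epis_def by blast
  qed
qed

end
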